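(* Let $\mathit{Exp}$ be the set of conditional expressions over a set $A$ of symbols, $\mathit{Exp}_\bot$ the corresponding flat domain, and let $norm:\mathit{Exp}_\bot\to\mathit{Exp}_\bot$ be a continuous (equivalently, monotone) function satisfying, for all $a\in A$ and all $u,v,w,y,z\in\mathit{Exp}$, $$norm(At(a))=At(a),$$ $$norm(\mathit{If}(At(a),y,z))=\mathit{If}(At(a),norm(y),norm(z)),$$ $$norm(\mathit{If}(\mathit{If}(u,v,w),y,z))=norm(\mathit{If}(u,\mathit{If}(v,y,z),\mathit{If}(w,y,z))).$$ Let $norm_1$ be the structurally recursive function defined in the context. Then $norm(x)=norm_1(x)$ for every $x\in\mathit{Exp}$.
   Context: Fix a set $A$ of symbols. The set $\mathit{Exp}$ of conditional expressions is the inductive type freely generated by the constructors $At(a)$ for $a\in A$ and $\mathit{If}(x,y,z)$ for $x,y,z\in\mathit{Exp}$. The flat domain $\mathit{Exp}_\bot=\mathit{Exp}\cup\{\bot\}$ adds one undefined element $\bot$, ordered by $p\sqsubseteq q$ iff $p=\bot$ or $p=q$; $\mathit{If}$ is extended strictly to $\mathit{Exp}_\bot$, so $\mathit{If}(x,y,z)=\bot$ if any of $x,y,z$ is $\bot$. The elements of $\mathit{Exp}$ are the defined elements. The function $normif:\mathit{Exp}\times\mathit{Exp}\times\mathit{Exp}\to\mathit{Exp}$ is defined by structural recursion on its first argument (for all values of the second and third): $$normif(At(a),y,z)=\mathit{If}(At(a),y,z),$$ $$normif(\mathit{If}(u,v,w),y,z)=normif(u,\,normif(v,y,z),\,normif(w,y,z)).$$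 The function $norm_1:\mathit{Exp}\to\mathit{Exp}$ is defined by structural recursion: $$norm_1(At(a))=At(a),\qquad norm_1(\mathit{If}(x,y,z))=normif(x,norm_1(y),norm_1(z)).$$ *)

theory Defs
  imports Main "HOL-Library.Complete_Partial_Order2"
begin

datatype 'a exp = At 'a | IF "'a exp" "'a exp" "'a exp"

text \<open>The flat domain over expressions: \<open>None\<close> is the undefined element, \<open>Some\<close> embeds the
  defined ones. Its order and least upper bounds are the library's \<open>flat_ord None\<close> and
  \<open>flat_lub None\<close>.\<close>

type_synonym 'a exp_bot = "'a exp option"

abbreviation exp_le :: "'a exp_bot \<Rightarrow> 'a exp_bot \<Rightarrow> bool" where
  "exp_le \<equiv> flat_ord None"

abbreviation exp_lub :: "'a exp_bot set \<Rightarrow> 'a exp_bot" where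
  "exp_lub \<equiv> flat_lub None"

fun IF_bot :: "'a exp_bot \<Rightarrow> 'a exp_bot \<Rightarrow> 'a exp_bot \<Rightarrow> 'a exp_bot" where
  "IF_bot (Some x) (Some y) (Some z) = Some (IF x y z)"
| "IF_bot _ _ _ = None"

definition exp_continuous :: "('a exp_bot \<Rightarrow> 'a exp_bot) \<Rightarrow> bool" where
  "exp_continuous f \<longleftrightarrow> mcont exp_lub exp_le exp_lub exp_le f"

lemma exp_continuous_iff_monotone: "exp_continuous f \<longleftrightarrow> monotone exp_le exp_le f"
proof
  assume "exp_continuous f"
  then show "monotone exp_le exp_le f"
    by (simp add: exp_continuous_def mcont_def)
next
  assume m: "monotone exp_le exp_le f"
  have "f (exp_lub Y) = exp_lub (f ` Y)"
    if ch: "Complete_Partial_Order.chain exp_le Y" and ne: "Y \<noteq> {}" for Y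
  proof -
    have "exp_lub Y \<in> Y \<and> (\<forall>y\<in>Y. exp_le y (exp_lub Y))"
    proof (cases "Y \<subseteq> {None}")
      case True
      then show ?thesis using ne by (auto simp: flat_lub_def flat_ord_def)
    next
      case False
      then obtain x where x: "Some x \<in> Y" by (metis insertI1 option.exhaust subsetI)
      then have Y: "Y - {None} = {Some x}"
        using ch by (auto simp: chain_def flat_ord_def)
      then have "exp_lub Y = Some x" using False by (simp add: flat_lub_def)
      then show ?thesis using x Y by (auto simp: flat_ord_def)
    qed
    then obtain s where s: "exp_lub Y = s" "s \<in> Y" "\<forall>y\<in>Y. exp_le y s" by blast
    have up: "exp_le (f y) (f s)" if "y \<in> Y" for y
      using m s that by (auto simp: monotone_def monotone_on_def)
    have "exp_lub (f ` Y) = f s"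
    proof (cases "f s = None")
      case True
      then have "f ` Y \<subseteq> {None}" using up by (auto simp: flat_ord_def)
      then show ?thesis using True by (simp add: flat_lub_def)
    next
      case False
      then have "f ` Y - {None} = {f s}" using up s(2) by (auto simp: flat_ord_def)
      moreover have "\<not> f ` Y \<subseteq> {None}" using False s(2) by auto
      ultimately show ?thesis by (simp add: flat_lub_def)
    qed
    then show ?thesis using s by simp
  qed
  then show "exp_continuous f"
    using m by (simp add: exp_continuous_def mcont_def cont_def)
qed

primrec normif :: "'a exp \<Rightarrow> 'a exp \<Rightarrow> 'a exp \<Rightarrow> 'a exp" where
  "normif (At a) y z = IF (At a) y z"
| "normif (IF u v w) y z = normif u (normif v y z) (normif w y z)"

primrec norm1 :: "'a exp \<Rightarrow> 'a exp" where
  "norm1 (At a) = At a"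
| "norm1 (IF x y z) = normif x (norm1 y) (norm1 z)"

end

theory Submission imports Defs begin

text \<open>The third equation for \<open>norm\<close> duplicates the branches, but each new
  condition \<open>u\<close>, \<open>v\<close>, \<open>w\<close> is a part of the old one. So
  structural induction on the condition, for all branches at once, proves
  \<open>norm_IF_eq_normif\<close>: definedness and value together, given that both branches have
  defined normal forms. A second induction, on the whole expression, supplies those normal
  forms.\<close>

lemma norm_IF_eq_normif:
  fixes norm :: "'a exp_bot \<Rightarrow> 'a exp_bot"
  assumes IF_At: "\<And>a y z. norm (Some (IF (At a) y z))
           = IF_bot (Some (At a)) (norm (Some y)) (norm (Some z))"
    and IF_IF: "\<And>u v w y z. norm (Some (IF (IF u v w) y z))
           = norm (Some (IF u (IF v y z) (IF w y z)))"
    and "norm (Some y) = Some y'" and "norm (Some z) = Some z'"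
  shows "norm (Some (IF x y z)) = Some (normif x y' z')"
  using assms(3,4)
proof (induction x arbitrary: y z y' z')
  case (At a)
  \<comment> \<open>Both branches have defined values, so the strict \<open>IF_bot\<close> does not
    collapse to \<open>None\<close>.\<close>
  then show ?case by (simp add: IF_At)
next
  case (IF u v w)
  have "norm (Some (IF v y z)) = Some (normif v y' z')"
    and "norm (Some (IF w y z)) = Some (normif w y' z')"
    using IF.IH(2,3) IF.prems by blast+
  \<comment> \<open>The hypothesis for \<open>u\<close> is applied to the new branches
    \<open>IF v y z\<close> and \<open>IF w y z\<close>, hence the generalization over branches and
    their values.\<close>
  then have "norm (Some (IF u (IF v y z) (IF w y z)))
      = Some (normif u (normif v y' z') (normif w y' z'))"
    by (rule IF.IH(1))
  then show ?case by (simp add: IF_IF)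
qed

theorem mainTheorem3:
  fixes norm :: "'a exp_bot \<Rightarrow> 'a exp_bot"
  assumes "exp_continuous norm"
    and "\<And>a. norm (Some (At a)) = Some (At a)"
    and "\<And>a y z. norm (Some (IF (At a) y z))
           = IF_bot (Some (At a)) (norm (Some y)) (norm (Some z))"
    and "\<And>u v w y z. norm (Some (IF (IF u v w) y z))
           = norm (Some (IF u (IF v y z) (IF w y z)))"
  shows "\<forall>x. norm (Some x) = Some (norm1 x)"
proof
  fix x
  show "norm (Some x) = Some (norm1 x)"
  proof (induction x)
    case (At a)
    show ?case by (simp add: assms(2))
  next
    case (IF x y z)
    \<comment> \<open>The induction hypotheses for \<open>y\<close> and \<open>z\<close> give the
      defined branch values \<open>norm1 y\<close> and \<open>norm1 z\<close>.\<close>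
    have "norm (Some (IF x y z)) = Some (normif x (norm1 y) (norm1 z))"
      using assms(3,4) IF.IH(2,3) by (rule norm_IF_eq_normif)
    then show ?case by simp
  qed
qed

end
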